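(* The variety $\mathbf{SPS}$ of all strict pseudosemilattices is inherently non-finitely based.
   Context: A pseudosemilattice is a set with a binary operation $\wedge$ satisfying the identities (PS1) $x\wedge x\approx x$; (PS2) $(x\wedge y)\wedge(x\wedge z)\approx(x\wedge y)\wedge z$; (PS3) $((x\wedge y)\wedge(x\wedge z))\wedge(x\wedge w)\approx(x\wedge y)\wedge((x\wedge z)\wedge(x\wedge w))$; and the left-right duals (PS2') $(z\wedge x)\wedge(y\wedge x)\approx z\wedge(y\wedge x)$ and (PS3') $(w\wedge x)\wedge((z\wedge x)\wedge(y\wedge x))\approx((w\wedge x)\wedge(z\wedge x))\wedge(y\wedge x)$. $\mathbf{SPS}$ is the variety generated by the pseudosemilattice $E_2$ of idempotents of the five-element combinatorial non-orthodox completely $0$-simple semigroup $A_2$. Explicitly, $E_2=\{0,e_{11},e_{12},e_{21}\}$ where $0$ is absorbing for $\wedge$ and $e_{i\lambda}\wedge e_{j\mu}=e_{i\mu}$ if $(i,\mu)\neq(2,2)$, while $e_{i\lambda}\wedge e_{j\mu}=0$ if $(i,\mu)=(2,2)$. It is the unique least non-associative variety of pseudosemilattices. A variety is locally finite if all its finitely generated members are finite; it is finitely based if it is definable by finitely many identities. A locally finite variety $\mathbf{V}$ is inherently non-finitely based if $\mathbf{V}$ is not contained in any finitely based locally finite variety (of algebras with one binary operation). *)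

theory Defs
  imports HOL.Hull "HOL-Algebra.Congruence"
begin

record 'a groupoid = "'a partial_object" +
  wedge :: "'a \<Rightarrow> 'a \<Rightarrow> 'a"

definition closed_under_wedge :: "'a groupoid \<Rightarrow> 'a set \<Rightarrow> bool" where
  "closed_under_wedge A S \<longleftrightarrow> (\<forall>x\<in>S. \<forall>y\<in>S. wedge A x y \<in> S)"

definition is_algebra :: "'a groupoid \<Rightarrow> bool" where
  "is_algebra A \<longleftrightarrow> carrier A \<noteq> {} \<and> closed_under_wedge A (carrier A)"

definition isomorphic :: "'a groupoid \<Rightarrow> 'b groupoid \<Rightarrow> bool" where
  "isomorphic A B \<longleftrightarrow>
     (\<exists>f. bij_betw f (carrier A) (carrier B) \<and>
          (\<forall>x\<in>carrier A. \<forall>y\<in>carrier A. f (wedge A x y) = wedge B (f x) (f y)))"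

definition subuniverse :: "'a groupoid \<Rightarrow> 'a set \<Rightarrow> bool" where
  "subuniverse A S \<longleftrightarrow> S \<subseteq> carrier A \<and> closed_under_wedge A S"

definition finitely_generated :: "'a groupoid \<Rightarrow> bool" where
  "finitely_generated A \<longleftrightarrow>
     (\<exists>X. finite X \<and> X \<subseteq> carrier A \<and> subuniverse A hull X = carrier A)"

datatype trm = Var nat | Wedge trm trm (infixl "\<diamondop>" 70)

type_synonym identity = "trm \<times> trm"

primrec eval_trm :: "'a groupoid \<Rightarrow> (nat \<Rightarrow> 'a) \<Rightarrow> trm \<Rightarrow> 'a" where
  "eval_trm A v (Var n) = v n"
| "eval_trm A v (s \<diamondop> t) = wedge A (eval_trm A v s) (eval_trm A v t)"

definition satisfies :: "'a groupoid \<Rightarrow> identity \<Rightarrow> bool" where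
  "satisfies A e \<longleftrightarrow>
     (\<forall>v. range v \<subseteq> carrier A \<longrightarrow> eval_trm A v (fst e) = eval_trm A v (snd e))"

text \<open>
  A variety is an equational class. As HOL has no proper classes, the algebras of a class have
  their carriers inside a fixed type \<open>'u\<close>. If \<open>'u\<close> is infinite, it contains an isomorphic copy of
  every countable algebra, hence of every finitely generated one. So for such \<open>'u\<close> a variety is
  determined by its members over \<open>'u\<close>, and inclusion of varieties and local finiteness have their
  usual meaning.
\<close>

definition models :: "identity set \<Rightarrow> 'u groupoid set" where
  "models \<Sigma> = {A. is_algebra A \<and> (\<forall>e\<in>\<Sigma>. satisfies A e)}"

definition variety :: "'u groupoid set \<Rightarrow> bool" where
  "variety V \<longleftrightarrow> (\<exists>\<Sigma>. V = models \<Sigma>)"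

definition finitely_based :: "'u groupoid set \<Rightarrow> bool" where
  "finitely_based V \<longleftrightarrow> (\<exists>\<Sigma>. finite \<Sigma> \<and> V = models \<Sigma>)"

definition locally_finite :: "'u groupoid set \<Rightarrow> bool" where
  "locally_finite V \<longleftrightarrow> (\<forall>A\<in>V. finitely_generated A \<longrightarrow> finite (carrier A))"

definition inherently_nonfinitely_based :: "'u groupoid set \<Rightarrow> bool" where
  "inherently_nonfinitely_based V \<longleftrightarrow>
     variety V \<and> locally_finite V \<and>
     \<not> (\<exists>W. variety W \<and> finitely_based W \<and> locally_finite W \<and> V \<subseteq> W)"

text \<open>
  The generating algebra may live over a type other than \<open>'u\<close>; it is represented by its isomorphic
  copies over \<open>'u\<close>, so \<open>'u\<close> has to be large enough to contain one.
\<close>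

definition generated_variety :: "'a groupoid \<Rightarrow> 'u groupoid set" where
  "generated_variety A = \<Inter>{V. variety V \<and> (\<forall>B. isomorphic A B \<longrightarrow> B \<in> V)}"

datatype E2_elem = Zero | E nat nat

fun E2_wedge :: "E2_elem \<Rightarrow> E2_elem \<Rightarrow> E2_elem" where
  "E2_wedge (E i l) (E j m) = (if (i, m) = (2, 2) then Zero else E i m)"
| "E2_wedge Zero y = Zero"
| "E2_wedge x Zero = Zero"

definition E2 :: "E2_elem groupoid" where
  "E2 = \<lparr>carrier = {Zero, E 1 1, E 1 2, E 2 1}, wedge = E2_wedge\<rparr>"

definition SPS :: "'u groupoid set" where
  "SPS = generated_variety E2"

definition pseudosemilattice_identities :: "identity set" where
  "pseudosemilattice_identities =
    (let x = Var 0; y = Var 1; z = Var 2; w = Var 3 in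
     {(x \<diamondop> x, x),
      ((x \<diamondop> y) \<diamondop> (x \<diamondop> z), (x \<diamondop> y) \<diamondop> z),
      (((x \<diamondop> y) \<diamondop> (x \<diamondop> z)) \<diamondop> (x \<diamondop> w), (x \<diamondop> y) \<diamondop> ((x \<diamondop> z) \<diamondop> (x \<diamondop> w))),
      ((z \<diamondop> x) \<diamondop> (y \<diamondop> x), z \<diamondop> (y \<diamondop> x)),
      ((w \<diamondop> x) \<diamondop> ((z \<diamondop> x) \<diamondop> (y \<diamondop> x)), ((w \<diamondop> x) \<diamondop> (z \<diamondop> x)) \<diamondop> (y \<diamondop> x))})"

lemma E2_pseudosemilattice: "E2 \<in> models pseudosemilattice_identities"
proof -
  have alg: "is_algebra E2"
    by (auto simp: is_algebra_def closed_under_wedge_def E2_def)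
  have "satisfies E2 e" if "e \<in> pseudosemilattice_identities" for e
    unfolding satisfies_def
  proof (intro allI impI)
    fix v :: "nat \<Rightarrow> E2_elem" assume "range v \<subseteq> carrier E2"
    then have *: "v n \<in> carrier E2" for n by auto
    have "\<forall>x\<in>carrier E2. \<forall>y\<in>carrier E2. \<forall>z\<in>carrier E2. \<forall>w\<in>carrier E2.
      eval_trm E2 ((\<lambda>_. w)(0 := x, 1 := y, 2 := z)) (fst e) =
      eval_trm E2 ((\<lambda>_. w)(0 := x, 1 := y, 2 := z)) (snd e)"
      using that unfolding pseudosemilattice_identities_def Let_def
      by (elim insertE; simp add: E2_def)
    then show "eval_trm E2 v (fst e) = eval_trm E2 v (snd e)"
      using that *[of 0] *[of 1] *[of 2] *[of 3] unfolding pseudosemilattice_identities_def Let_def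
      by (elim insertE; simp; blast)
  qed
  with alg show ?thesis by (simp add: models_def)
qed

lemma eval_trm_in_carrier:
  assumes "is_algebra A" "range v \<subseteq> carrier A"
  shows "eval_trm A v t \<in> carrier A"
  using assms by (induction t) (auto simp: is_algebra_def closed_under_wedge_def)

lemma isomorphic_models_iff:
  assumes "isomorphic A B" "is_algebra A"
  shows "B \<in> models \<Sigma> \<longleftrightarrow> A \<in> models \<Sigma>"
proof -
  obtain f where f: "bij_betw f (carrier A) (carrier B)"
    and hom: "\<And>x y. x \<in> carrier A \<Longrightarrow> y \<in> carrier A \<Longrightarrow> f (wedge A x y) = wedge B (f x) (f y)"
    using assms(1) by (auto simp: isomorphic_def)
  have img: "f ` carrier A = carrier B" and inj: "inj_on f (carrier A)"
    using f by (auto simp: bij_betw_def)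
  have algB: "is_algebra B"
    unfolding is_algebra_def closed_under_wedge_def img[symmetric]
    using assms(2) hom[symmetric]
    by (auto simp: is_algebra_def closed_under_wedge_def)
  have ev: "eval_trm B (f \<circ> v) t = f (eval_trm A v t)" if "range v \<subseteq> carrier A" for v t
    using that by (induction t) (auto simp: hom eval_trm_in_carrier[OF assms(2)])
  have "satisfies B e \<longleftrightarrow> satisfies A e" for e
  proof
    assume B: "satisfies B e"
    show "satisfies A e"
      unfolding satisfies_def
    proof (intro allI impI)
      fix v :: "nat \<Rightarrow> 'a" assume v: "range v \<subseteq> carrier A"
      then have "range (f \<circ> v) \<subseteq> carrier B" using img by auto
      then have "f (eval_trm A v (fst e)) = f (eval_trm A v (snd e))"
        using B ev[OF v] by (metis satisfies_def)
      then show "eval_trm A v (fst e) = eval_trm A v (snd e)"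
        using inj eval_trm_in_carrier[OF assms(2) v] by (auto dest: inj_onD)
    qed
  next
    assume A: "satisfies A e"
    show "satisfies B e"
      unfolding satisfies_def
    proof (intro allI impI)
      fix v :: "nat \<Rightarrow> 'b" assume v: "range v \<subseteq> carrier B"
      define u where "u = inv_into (carrier A) f \<circ> v"
      have u: "range u \<subseteq> carrier A" and fu: "f \<circ> u = v"
        using v img by (auto simp: u_def fun_eq_iff f_inv_into_f subset_iff intro!: inv_into_into)
      show "eval_trm B v (fst e) = eval_trm B v (snd e)"
        using A u ev[OF u] by (simp add: satisfies_def fu)
    qed
  qed
  then show ?thesis using assms(2) algB by (simp add: models_def)
qed

lemma SPS_eq_models:
  assumes "infinite (UNIV :: 'u set)"
  shows "(SPS :: 'u groupoid set) = models {e. satisfies E2 e}"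
proof -
  have alg: "is_algebra E2" using E2_pseudosemilattice by (simp add: models_def)
  have "finite (carrier E2)" by (simp add: E2_def)
  then obtain g :: "E2_elem \<Rightarrow> 'u" where g: "inj_on g (carrier E2)"
    using infinite_arbitrarily_large[OF assms, of "card (carrier E2)"]
    by (metis finite_same_card_bij bij_betw_imp_inj_on)
  define B where "B = \<lparr>carrier = g ` carrier E2,
    wedge = (\<lambda>x y. g (E2_wedge (inv_into (carrier E2) g x) (inv_into (carrier E2) g y)))\<rparr>"
  have "isomorphic E2 B"
    unfolding isomorphic_def
    by (rule exI[of _ g]) (use g in \<open>auto simp: B_def bij_betw_def E2_def\<close>)
  then have iff: "(\<forall>B :: 'u groupoid. isomorphic E2 B \<longrightarrow> B \<in> models \<Sigma>) \<longleftrightarrow> E2 \<in> models \<Sigma>" for \<Sigma>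
    using isomorphic_models_iff[OF _ alg] by blast
  have "variety V \<and> (\<forall>B :: 'u groupoid. isomorphic E2 B \<longrightarrow> B \<in> V) \<longleftrightarrow>
      (\<exists>\<Sigma>. V = models \<Sigma> \<and> E2 \<in> models \<Sigma>)" for V
    unfolding variety_def using iff by metis
  then have "(SPS :: 'u groupoid set) = \<Inter>{V. \<exists>\<Sigma>. V = models \<Sigma> \<and> E2 \<in> models \<Sigma>}"
    by (simp add: SPS_def generated_variety_def)
  also have "\<dots> = models {e. satisfies E2 e}"
  proof
    show "\<Inter>{V :: 'u groupoid set. \<exists>\<Sigma>. V = models \<Sigma> \<and> E2 \<in> models \<Sigma>} \<subseteq> models {e. satisfies E2 e}"
    proof (rule Inter_lower, rule CollectI, intro exI conjI)
      show "E2 \<in> models {e. satisfies E2 e}" using alg by (simp add: models_def)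
    qed (rule refl)
    show "models {e. satisfies E2 e} \<subseteq> \<Inter>{V :: 'u groupoid set. \<exists>\<Sigma>. V = models \<Sigma> \<and> E2 \<in> models \<Sigma>}"
      by (auto simp: models_def)
  qed
  finally show ?thesis .
qed

end

theory Submission
  imports Defs "HOL-Library.Countable_Set"
begin

text \<open>
  Call the pair of the leftmost and the rightmost variable of a subterm of \<open>t\<close> an edge of \<open>t\<close>; so
  \<open>t\<close> spans a bipartite graph, with a left and a right copy of each of its variables as vertices.
  A product of nonzero elements of \<open>E\<^sub>2\<close> keeps the row of its left factor and the column of its
  right factor, unless this is the forbidden pair \<open>(2, 2)\<close>. Hence the value of \<open>t\<close> in \<open>E\<^sub>2\<close> depends on the outermost
  variables and on the set of edges only, and conversely these are determined by the values
  (\<open>satisfies_E2_iff\<close>). As there are finitely many graphs on finitely many variables, the variety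
  is locally finite (\<open>locally_finite_SPS\<close>).

  Now let \<open>N\<close> be large. The edges of the cycle of length \<open>2N\<close>, together with a zero, form a
  groupoid: the product of two edges is the edge joining the left end of the first to the right end
  of the second, or zero if there is no such edge. It satisfies the identities of \<open>E\<^sub>2\<close>. The
  infinite path covers the cycle. Take the finite intervals of this path with a distinguished
  edge, up to the deck translations, and let the product be the union of the two intervals, placed
  so that their distinguished edges multiply. By walking around the cycle again and again, the
  finitely many single edges generate arbitrarily long intervals. But an identity in fewer than
  \<open>N\<close> variables involves fewer than \<open>N\<close> right vertices of the cycle, so the cycle can be cut at
  another right vertex; over what is left the covering is trivial, intervals are just multiplied in
  the product of an edge groupoid and a semilattice (with the pairs over zero identified), and so the identity holds whenever it holds
  in \<open>E\<^sub>2\<close> (\<open>winding_satisfies\<close>). A finite set of identities of \<open>E\<^sub>2\<close> has only finitely many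
  variables, so it has an infinite finitely generated model.
\<close>

section \<open>Terms as bipartite graphs\<close>

primrec leftmost :: "trm \<Rightarrow> nat" where
  "leftmost (Var x) = x"
| "leftmost (s \<diamondop> t) = leftmost s"

primrec rightmost :: "trm \<Rightarrow> nat" where
  "rightmost (Var x) = x"
| "rightmost (s \<diamondop> t) = rightmost t"

primrec vars :: "trm \<Rightarrow> nat set" where
  "vars (Var x) = {x}"
| "vars (s \<diamondop> t) = vars s \<union> vars t"

primrec edges :: "trm \<Rightarrow> (nat \<times> nat) set" where
  "edges (Var x) = {(x, x)}"
| "edges (s \<diamondop> t) = insert (leftmost s, rightmost t) (edges s \<union> edges t)"

lemma leftmost_in_vars [simp]: "leftmost t \<in> vars t"
  by (induction t) auto

lemma rightmost_in_vars [simp]: "rightmost t \<in> vars t"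
  by (induction t) auto

lemma finite_vars [simp]: "finite (vars t)"
  by (induction t) auto

lemma vars_nonempty [simp]: "vars t \<noteq> {}"
  using leftmost_in_vars by blast

lemma vars_eq_Domain_edges: "vars t = Domain (edges t)"
  by (induction t) (auto simp flip: Domain_iff)

lemma edges_subset: "edges t \<subseteq> vars t \<times> vars t"
  by (induction t) auto

text \<open>
  The common pattern of evaluation in \<open>E\<^sub>2\<close> and in the algebras constructed below: nonzero values
  are described by a content and a left and a right end, and \<open>ok p q\<close> tells whether the left end
  given by \<open>p\<close> and the right end given by \<open>q\<close> may be joined. As zero is absorbing, each subterm
  has to join compatible ends if the value is to be nonzero.
\<close>

lemma eval_trm_by_edges:
  assumes var: "\<And>x. x \<in> V \<Longrightarrow> v x = (if ok x x then val {x} x x else z)"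
    and zero: "\<And>x. wedge A z x = z" "\<And>x. wedge A x z = z"
    and wedge: "\<And>X Y p q p' q'. \<lbrakk>finite X; finite Y; X \<noteq> {}; Y \<noteq> {}; {p, q, p', q'} \<subseteq> V\<rbrakk> \<Longrightarrow>
      wedge A (val X p q) (val Y p' q') = (if ok p q' then val (X \<union> Y) p q' else z)"
    and "vars t \<subseteq> V"
  shows "eval_trm A v t =
    (if \<forall>(p, q) \<in> edges t. ok p q then val (vars t) (leftmost t) (rightmost t) else z)"
  using \<open>vars t \<subseteq> V\<close>
proof (induction t)
  case (Var x)
  then show ?case by (simp add: var)
next
  case (Wedge s t)
  have "{leftmost s, rightmost s, leftmost t, rightmost t} \<subseteq> V"
    using Wedge.prems leftmost_in_vars rightmost_in_vars by fastforce
  then have "wedge A (val (vars s) (leftmost s) (rightmost s)) (val (vars t) (leftmost t) (rightmost t)) =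
      (if ok (leftmost s) (rightmost t) then val (vars s \<union> vars t) (leftmost s) (rightmost t) else z)"
    by (intro wedge) auto
  with Wedge show ?case by (auto simp: zero)
qed

text \<open>
  With \<open>P\<close> the variables in row 2 and \<open>Q\<close> those in column 2, the zero of \<open>E\<^sub>2\<close> takes the place of
  the missing idempotent in row 2 and column 2.
\<close>

definition E2_assignment :: "nat set \<Rightarrow> nat set \<Rightarrow> nat \<Rightarrow> E2_elem" where
  "E2_assignment P Q x =
    (if x \<in> P \<inter> Q then Zero else E (if x \<in> P then 2 else 1) (if x \<in> Q then 2 else 1))"

lemma range_E2_assignment: "range (E2_assignment P Q) \<subseteq> carrier E2"
  by (auto simp: E2_assignment_def E2_def split: if_splits)

lemma E2_assignment_exhaust:
  assumes "range v \<subseteq> carrier E2"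
  shows "\<exists>P Q. v = E2_assignment P Q"
proof (intro exI ext)
  fix x
  have "v x \<in> carrier E2" using assms by auto
  then show "v x = E2_assignment {x. v x \<in> {Zero, E 2 1}} {x. v x \<in> {Zero, E 1 2}} x"
    by (auto simp: E2_assignment_def E2_def)
qed

lemma E2_wedge_Zero: "E2_wedge x Zero = Zero"
  by (cases x) auto

lemma eval_E2_assignment:
  "eval_trm E2 (E2_assignment P Q) t =
    (if \<forall>(p, q) \<in> edges t. \<not> (p \<in> P \<and> q \<in> Q)
     then E (if leftmost t \<in> P then 2 else 1) (if rightmost t \<in> Q then 2 else 1) else Zero)"
proof (rule eval_trm_by_edges[where V = UNIV])
  let ?E = "\<lambda>p q. E (if p \<in> P then 2 else 1) (if q \<in> Q then 2 else 1)"
  show "E2_assignment P Q x = (if \<not> (x \<in> P \<and> x \<in> Q) then ?E x x else Zero)" for x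
    by (simp add: E2_assignment_def)
  show "wedge E2 (?E p q) (?E p' q') = (if \<not> (p \<in> P \<and> q' \<in> Q) then ?E p q' else Zero)" for p q p' q'
    by (simp add: E2_def)
qed (simp_all add: E2_def E2_wedge_Zero)

text \<open>
  For the converse direction, a single variable in row 2 detects whether it is the leftmost one;
  dually for the rightmost one. A single \<open>p\<close> in row 2 and a single \<open>q\<close> in column 2 give the value
  zero exactly if \<open>(p, q)\<close> is an edge.
\<close>

lemma satisfies_E2_iff:
  "satisfies E2 (s, t) \<longleftrightarrow> leftmost s = leftmost t \<and> rightmost s = rightmost t \<and> edges s = edges t"
proof
  assume "satisfies E2 (s, t)"
  then have eq: "eval_trm E2 (E2_assignment P Q) s = eval_trm E2 (E2_assignment P Q) t" for P Q
    using range_E2_assignment by (simp add: satisfies_def)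
  have "leftmost s = leftmost t"
    using eq[of "{leftmost s}" "{}"] by (auto simp: eval_E2_assignment split: if_splits)
  moreover have "rightmost s = rightmost t"
    using eq[of "{}" "{rightmost s}"] by (auto simp: eval_E2_assignment split: if_splits)
  moreover have "(p, q) \<in> edges s \<longleftrightarrow> (p, q) \<in> edges t" for p q
    using eq[of "{p}" "{q}"] unfolding eval_E2_assignment by (auto split: if_splits)
  ultimately show "leftmost s = leftmost t \<and> rightmost s = rightmost t \<and> edges s = edges t"
    by auto
next
  assume "leftmost s = leftmost t \<and> rightmost s = rightmost t \<and> edges s = edges t"
  then show "satisfies E2 (s, t)"
    unfolding satisfies_def using E2_assignment_exhaust by (force simp: eval_E2_assignment)
qed

section \<open>Local finiteness\<close>

lemma eval_trm_image_subuniverse: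
  assumes "is_algebra A" "range v \<subseteq> carrier A"
  shows "subuniverse A (eval_trm A v ` {t. vars t \<subseteq> V})"
proof -
  have "wedge A (eval_trm A v s) (eval_trm A v t) \<in> eval_trm A v ` {t. vars t \<subseteq> V}"
    if "vars s \<subseteq> V" "vars t \<subseteq> V" for s t
    by (rule image_eqI[of _ _ "s \<diamondop> t"]) (use that in auto)
  then show ?thesis
    using eval_trm_in_carrier[OF assms] by (auto simp: subuniverse_def closed_under_wedge_def)
qed

lemma locally_finite_SPS:
  assumes "infinite (UNIV :: 'u set)"
  shows "locally_finite (SPS :: 'u groupoid set)"
  unfolding locally_finite_def SPS_eq_models[OF assms]
proof (intro ballI impI)
  fix A :: "'u groupoid"
  assume A: "A \<in> models {e. satisfies E2 e}" and "finitely_generated A"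
  then obtain X where X: "finite X" "X \<subseteq> carrier A" and hull: "subuniverse A hull X = carrier A"
    by (auto simp: finitely_generated_def)
  have alg: "is_algebra A" using A by (simp add: models_def)
  obtain c where c: "c \<in> carrier A" using alg by (auto simp: is_algebra_def)
  obtain n and f :: "nat \<Rightarrow> 'u" where f: "X = f ` {..<n}"
    using finite_imp_nat_seg_image_inj_on[OF X(1)] by (metis lessThan_def)
  \<comment> \<open>Only the values at the variables below \<open>n\<close> matter; the others just have to lie in \<open>A\<close>.\<close>
  define v where "v i = (if i < n then f i else c)" for i
  have v: "range v \<subseteq> carrier A" using f c X(2) by (auto simp: v_def)
  let ?T = "{t. vars t \<subseteq> {..<n}}"
  have "X \<subseteq> eval_trm A v ` ?T"
  proof
    fix x assume "x \<in> X"
    then obtain i where "i < n" "x = f i" using f by auto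
    then show "x \<in> eval_trm A v ` ?T" by (intro image_eqI[of _ _ "Var i"]) (auto simp: v_def)
  qed
  then have carrier: "carrier A \<subseteq> eval_trm A v ` ?T"
    using hull_minimal[of X "eval_trm A v ` ?T" "subuniverse A"]
      eval_trm_image_subuniverse[OF alg v] hull by simp
  let ?graph = "\<lambda>t. (leftmost t, rightmost t, edges t)"
  have "?graph ` ?T \<subseteq> {..<n} \<times> {..<n} \<times> Pow ({..<n} \<times> {..<n})"
    using leftmost_in_vars rightmost_in_vars edges_subset by fastforce
  then have "finite (?graph ` ?T)"
    by (rule finite_subset) simp
  moreover have "eval_trm A v ` ?T \<subseteq> (\<lambda>g. eval_trm A v (SOME t. ?graph t = g)) ` ?graph ` ?T"
  proof (rule image_subsetI)
    fix s assume "s \<in> ?T"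
    define t where "t = (SOME t. ?graph t = ?graph s)"
    have "?graph t = ?graph s"
      unfolding t_def by (rule someI) (rule refl)
    then have "satisfies A (s, t)" using A by (simp add: models_def satisfies_E2_iff)
    then have "eval_trm A v s = eval_trm A v t" using v by (simp add: satisfies_def)
    then show "eval_trm A v s \<in> (\<lambda>g. eval_trm A v (SOME t. ?graph t = g)) ` ?graph ` ?T"
      using \<open>s \<in> ?T\<close> unfolding t_def by blast
  qed
  ultimately have "finite (eval_trm A v ` ?T)"
    by (rule finite_surj)
  then show "finite (carrier A)" using carrier finite_subset by blast
qed

section \<open>Intervals winding around a long cycle\<close>

text \<open>
  The left and the right vertices of the cycle are two copies of the integers modulo \<open>N\<close>, and the
  left vertex \<open>a\<close> is adjacent to the right vertices \<open>a\<close> and \<open>a + 1\<close>. In \<open>Some (a, s, d)\<close>, the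
  distinguished edge joins the left vertex \<open>a\<close> to the right vertex \<open>a + s\<close>, and on the covering
  path \<open>a + d\<close> is the highest left vertex of the interval; the lower end of the interval is
  forgotten, as the upper one is enough to get infinitely many elements. In a product, the highest
  left vertex of the right factor is \<open>d' - s'\<close> above its right vertex \<open>a' + s'\<close>, which is placed at
  \<open>a + r\<close>; so it is \<open>d' - s' + r\<close> above the left vertex \<open>a\<close> of the left factor.
\<close>

fun winding_wedge ::
  "int \<Rightarrow> (int \<times> int \<times> int) option \<Rightarrow> (int \<times> int \<times> int) option \<Rightarrow> (int \<times> int \<times> int) option" where
  "winding_wedge N (Some (a, s, d)) (Some (a', s', d')) =
    (let r = (a' + s' - a) mod N
     in if r \<in> {0, 1} then Some (a, r, max d (d' - s' + r)) else None)"
| "winding_wedge N None y = None"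
| "winding_wedge N x None = None"

definition winding :: "int \<Rightarrow> (int \<times> int \<times> int) option groupoid" where
  "winding N = \<lparr>carrier = insert None (Some ` ({0..<N} \<times> {0, 1} \<times> {0..})), wedge = winding_wedge N\<rparr>"

lemma winding_wedge_None: "winding_wedge N x None = None"
  by (cases "(N, x, None :: (int \<times> int \<times> int) option)" rule: winding_wedge.cases) auto

lemma winding_is_algebra: "is_algebra (winding N)"
  by (auto simp: is_algebra_def closed_under_wedge_def winding_def Let_def)

lemma infinite_winding:
  assumes "0 < N"
  shows "infinite (carrier (winding N))"
proof
  assume "finite (carrier (winding N))"
  then have "finite ((\<lambda>d. Some (0 :: int, 0 :: int, d)) ` {0 :: int ..})"
    by (rule rev_finite_subset) (use assms in \<open>auto simp: winding_def\<close>)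
  then have "finite {0 :: int ..}"
    by (rule finite_imageD) (auto simp: inj_on_def)
  then show False using infinite_Ici by blast
qed

text \<open>
  An interval that reaches \<open>d\<close> above \<open>a + 1\<close> reaches \<open>d + 1\<close> above \<open>a\<close> once its distinguished edge
  has been moved down; as one may go down around the cycle forever, all reaches arise from the
  single edges.
\<close>

lemma winding_finitely_generated:
  assumes "2 \<le> N"
  shows "finitely_generated (winding N)"
proof -
  let ?X = "insert None (Some ` ({0..<N} \<times> {0, 1} \<times> {0}))"
  have carrier: "?X \<subseteq> carrier (winding N)" by (auto simp: winding_def)
  have "carrier (winding N) \<subseteq> S" if "?X \<subseteq> S" and S: "subuniverse (winding N) S" for S
  proof -
    have closed: "winding_wedge N x y \<in> S" if "x \<in> S" "y \<in> S" for x y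
      using S that by (auto simp: subuniverse_def closed_under_wedge_def winding_def)
    have "Some (a, s, int d) \<in> S" if "a \<in> {0..<N}" "s \<in> {0, 1}" for a s d
      using that
    proof (induction d arbitrary: a s)
      case 0
      then show ?case using \<open>?X \<subseteq> S\<close> by auto
    next
      case (Suc d)
      have "winding_wedge N (Some (a, 1, int d)) (Some ((a + 1) mod N, 0, int d)) =
          Some (a, 1, int (Suc d))"
        using assms by (simp add: Let_def mod_diff_left_eq)
      moreover have "Some (a, 1, int d) \<in> S" "Some ((a + 1) mod N, 0, int d) \<in> S"
        using Suc assms by auto
      ultimately have 1: "Some (a, 1, int (Suc d)) \<in> S"
        using closed by metis
      have "winding_wedge N (Some (a, 1, int (Suc d))) (Some (a, 0, 0)) = Some (a, 0, int (Suc d))"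
        by (simp add: Let_def)
      moreover have "Some (a, 0, 0) \<in> S"
        using Suc.prems \<open>?X \<subseteq> S\<close> by auto
      ultimately have "Some (a, 0, int (Suc d)) \<in> S"
        using closed 1 by metis
      with 1 Suc.prems show ?case by auto
    qed
    then have "Some (a, s, d) \<in> S" if "a \<in> {0..<N}" "s \<in> {0, 1}" "0 \<le> d" for a s d
      using that by (metis nonneg_int_cases)
    then show ?thesis using \<open>?X \<subseteq> S\<close> by (auto simp: winding_def)
  qed
  moreover have "subuniverse (winding N) (carrier (winding N))"
    using winding_is_algebra by (auto simp: subuniverse_def is_algebra_def)
  ultimately have "subuniverse (winding N) hull ?X = carrier (winding N)"
    using carrier by (intro hull_unique) auto
  then show ?thesis
    unfolding finitely_generated_def using carrier by (intro exI[of _ ?X]) auto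
qed

lemma eval_winding_None:
  assumes "x \<in> vars t" "v x = None"
  shows "eval_trm (winding N) v t = None"
  using assms by (induction t) (auto simp: winding_def winding_wedge_None)

text \<open>
  If the right vertex \<open>k\<close> of the cycle is not used, the rest of the cycle is a path, along which
  the coordinate of the left and right vertices is their distance above \<open>k\<close>, with values in
  \<open>{0..<N}\<close> and \<open>{1..<N}\<close>. In this coordinate, vertices are adjacent in the cycle only if they are
  adjacent on the path.
\<close>

lemma eval_winding_cut:
  assumes v: "\<forall>x \<in> vars t. v x = Some (a x, s x, d x)"
    and s: "\<forall>x \<in> vars t. s x \<in> {0, 1}"
    and k: "\<forall>x \<in> vars t. (a x + s x - k) mod N \<noteq> 0"
    and "0 < N"
  defines "\<alpha> \<equiv> \<lambda>x. (a x - k) mod N"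
  defines "\<beta> \<equiv> \<lambda>x. (a x + s x - k) mod N"
  shows "eval_trm (winding N) v t =
    (if \<forall>(p, q) \<in> edges t. \<beta> q - \<alpha> p \<in> {0, 1}
     then Some (a (leftmost t), \<beta> (rightmost t) - \<alpha> (leftmost t),
       Max ((\<lambda>x. \<alpha> x + d x) ` vars t) - \<alpha> (leftmost t))
     else None)"
proof -
  let ?V = "vars t"
  note v = v[rule_format] and s = s[rule_format] and k = k[rule_format]
  have \<alpha>: "0 \<le> \<alpha> x \<and> \<alpha> x < N" for x
    using \<open>0 < N\<close> by (simp add: \<alpha>_def)
  have \<beta>: "0 < \<beta> x \<and> \<beta> x < N" if "x \<in> ?V" for x
    using k[OF that] \<open>0 < N\<close> by (simp add: \<beta>_def order.not_eq_order_implies_strict)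
  have \<beta>_eq: "\<beta> x = \<alpha> x + s x" if "x \<in> ?V" for x
  proof -
    have \<beta>': "\<beta> x = (\<alpha> x + s x) mod N"
      using mod_add_left_eq[of "a x - k" N "s x"] by (simp add: \<alpha>_def \<beta>_def diff_add_eq)
    have "\<alpha> x + s x \<noteq> N"
      using \<beta>' \<beta>[OF that] by auto
    then have "0 \<le> \<alpha> x + s x \<and> \<alpha> x + s x < N"
      using \<alpha>[of x] s[OF that] by auto
    then show ?thesis using \<beta>' by simp
  qed
  have adjacent: "(a p' + (\<beta> q' - \<alpha> p') - a p) mod N \<in> {0, 1} \<longleftrightarrow> \<beta> q' - \<alpha> p \<in> {0, 1}"
    and diff: "\<beta> q' - \<alpha> p \<in> {0, 1} \<Longrightarrow> (a p' + (\<beta> q' - \<alpha> p') - a p) mod N = \<beta> q' - \<alpha> p"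
    if "q' \<in> ?V" for p p' q'
  proof -
    have \<alpha>_div: "\<alpha> x = a x - k - N * ((a x - k) div N)" for x
      by (simp add: \<alpha>_def minus_mult_div_eq_mod)
    have "a p' + (\<beta> q' - \<alpha> p') - a p =
        \<beta> q' - \<alpha> p + N * ((a p' - k) div N - (a p - k) div N)"
      unfolding right_diff_distrib using \<alpha>_div[of p] \<alpha>_div[of p'] by linarith
    then have "(a p' + (\<beta> q' - \<alpha> p') - a p) mod N = (\<beta> q' - \<alpha> p) mod N"
      by (simp only: mod_mult_self2)
    also have "\<dots> = (if \<alpha> p \<le> \<beta> q' then \<beta> q' - \<alpha> p else \<beta> q' - \<alpha> p + N)"
      using \<alpha>[of p] \<beta>[OF that] by (intro int_mod_pos_eq[where q = "if \<alpha> p \<le> \<beta> q' then 0 else -1"]) auto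
    finally have eq: "(a p' + (\<beta> q' - \<alpha> p') - a p) mod N =
        (if \<alpha> p \<le> \<beta> q' then \<beta> q' - \<alpha> p else \<beta> q' - \<alpha> p + N)" .
    then show "(a p' + (\<beta> q' - \<alpha> p') - a p) mod N \<in> {0, 1} \<longleftrightarrow> \<beta> q' - \<alpha> p \<in> {0, 1}"
      and "\<beta> q' - \<alpha> p \<in> {0, 1} \<Longrightarrow> (a p' + (\<beta> q' - \<alpha> p') - a p) mod N = \<beta> q' - \<alpha> p"
      using eq \<alpha>[of p] \<beta>[OF that] by (auto split: if_splits)
  qed
  show ?thesis
  proof (rule eval_trm_by_edges[where V = ?V and
        val = "\<lambda>X p q. Some (a p, \<beta> q - \<alpha> p, Max ((\<lambda>x. \<alpha> x + d x) ` X) - \<alpha> p)"])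
    show "v x = (if \<beta> x - \<alpha> x \<in> {0, 1}
        then Some (a x, \<beta> x - \<alpha> x, Max ((\<lambda>x. \<alpha> x + d x) ` {x}) - \<alpha> x) else None)" if "x \<in> ?V" for x
      using v[OF that] s[OF that] \<beta>_eq[OF that] by simp
    show "wedge (winding N) (Some (a p, \<beta> q - \<alpha> p, Max ((\<lambda>x. \<alpha> x + d x) ` X) - \<alpha> p))
        (Some (a p', \<beta> q' - \<alpha> p', Max ((\<lambda>x. \<alpha> x + d x) ` Y) - \<alpha> p')) =
      (if \<beta> q' - \<alpha> p \<in> {0, 1}
       then Some (a p, \<beta> q' - \<alpha> p, Max ((\<lambda>x. \<alpha> x + d x) ` (X \<union> Y)) - \<alpha> p) else None)"
      if "finite X" "finite Y" "X \<noteq> {}" "Y \<noteq> {}" "{p, q, p', q'} \<subseteq> ?V" for X Y p q p' q'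
    proof -
      have "Max ((\<lambda>x. \<alpha> x + d x) ` (X \<union> Y)) =
          max (Max ((\<lambda>x. \<alpha> x + d x) ` X)) (Max ((\<lambda>x. \<alpha> x + d x) ` Y))"
        using that by (simp add: image_Un Max_Un)
      then show ?thesis
        using adjacent[of q' p' p] diff[of q' p p'] that(5)
        by (auto simp: winding_def Let_def)
    qed
  qed (simp_all add: winding_def winding_wedge_None)
qed

text \<open>
  Each variable uses one right vertex of the cycle, so fewer than \<open>N\<close> variables leave one at which
  the cycle can be cut. Then the value of a term depends on the data that \<open>E\<^sub>2\<close> sees only.
\<close>

lemma winding_satisfies:
  assumes E2: "satisfies E2 (s, t)" and N: "int (card (vars s)) < N"
  shows "satisfies (winding N) (s, t)"
  unfolding satisfies_def fst_conv snd_conv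
proof (intro allI impI)
  fix v :: "nat \<Rightarrow> (int \<times> int \<times> int) option"
  assume range: "range v \<subseteq> carrier (winding N)"
  have same: "leftmost s = leftmost t" "rightmost s = rightmost t" "edges s = edges t"
    using E2 by (simp_all add: satisfies_E2_iff)
  then have vars: "vars s = vars t" by (simp add: vars_eq_Domain_edges)
  show "eval_trm (winding N) v s = eval_trm (winding N) v t"
  proof (cases "\<exists>x \<in> vars s. v x = None")
    case True
    then show ?thesis using eval_winding_None vars by metis
  next
    case False
    define a where "a = fst \<circ> the \<circ> v"
    define r where "r = fst \<circ> snd \<circ> the \<circ> v"
    define d where "d = snd \<circ> snd \<circ> the \<circ> v"
    have v: "\<forall>x \<in> vars s. v x = Some (a x, r x, d x)"
      using False by (auto simp: a_def r_def d_def)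
    have r: "\<forall>x \<in> vars s. r x \<in> {0, 1}"
    proof
      fix x assume "x \<in> vars s"
      moreover have "v x \<in> carrier (winding N)" using range by blast
      ultimately show "r x \<in> {0, 1}" using v by (auto simp: winding_def)
    qed
    have "0 < N" using N by linarith
    let ?R = "(\<lambda>x. (a x + r x) mod N) ` vars s"
    have "card ?R < card {0..<N}"
      using N card_image_le[of "vars s" "\<lambda>x. (a x + r x) mod N"] by simp
    then obtain k where k: "k \<in> {0..<N}" "k \<notin> ?R"
      by (meson card_mono finite_imageI finite_vars not_less subsetI)
    have nz: "\<forall>x \<in> vars s. (a x + r x - k) mod N \<noteq> 0"
    proof (intro ballI notI)
      fix x assume "x \<in> vars s" and "(a x + r x - k) mod N = 0"
      then have "(a x + r x) mod N = k mod N"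
        by (simp add: mod_eq_dvd_iff mod_eq_0_iff_dvd)
      also have "\<dots> = k" using k(1) by simp
      finally show False using k(2) \<open>x \<in> vars s\<close> by blast
    qed
    show ?thesis
      unfolding eval_winding_cut[OF v r nz \<open>0 < N\<close>]
        eval_winding_cut[OF v[unfolded vars] r[unfolded vars] nz[unfolded vars] \<open>0 < N\<close>] same vars ..
  qed
qed

section \<open>Inherent nonfinite basis\<close>

lemma exists_isomorphic_copy:
  assumes "infinite (UNIV :: 'u set)" "countable (carrier A)" "is_algebra A"
  shows "\<exists>B :: 'u groupoid. isomorphic A B"
proof -
  obtain h :: "nat \<Rightarrow> 'u" where h: "inj h"
    using infinite_countable_subset[OF assms(1)] by blast
  define g where "g = h \<circ> to_nat_on (carrier A)"
  have g: "inj_on g (carrier A)"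
    unfolding g_def using assms(2) h by (auto intro: comp_inj_on inj_on_subset)
  define B where "B = \<lparr>carrier = g ` carrier A,
    wedge = (\<lambda>x y. g (wedge A (inv_into (carrier A) g x) (inv_into (carrier A) g y)))\<rparr>"
  have "isomorphic A B"
    unfolding isomorphic_def
    by (rule exI[of _ g]) (use g in \<open>auto simp: B_def bij_betw_def\<close>)
  then show ?thesis ..
qed

lemma isomorphic_finitely_generated:
  assumes "isomorphic A B" "is_algebra A" "finitely_generated A"
  shows "finitely_generated B"
proof -
  obtain f where f: "bij_betw f (carrier A) (carrier B)"
    and hom: "\<And>x y. x \<in> carrier A \<Longrightarrow> y \<in> carrier A \<Longrightarrow> f (wedge A x y) = wedge B (f x) (f y)"
    using assms(1) by (auto simp: isomorphic_def)
  have img: "f ` carrier A = carrier B" using f by (simp add: bij_betw_def)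
  obtain X where X: "finite X" "X \<subseteq> carrier A" "subuniverse A hull X = carrier A"
    using assms(3) by (auto simp: finitely_generated_def)
  have "carrier B \<subseteq> S" if S: "f ` X \<subseteq> S" "subuniverse B S" for S
  proof -
    have "subuniverse A {x \<in> carrier A. f x \<in> S}"
      using S(2) assms(2) by (auto simp: subuniverse_def closed_under_wedge_def is_algebra_def hom)
    then have "carrier A \<subseteq> {x \<in> carrier A. f x \<in> S}"
      using hull_minimal[of X "{x \<in> carrier A. f x \<in> S}" "subuniverse A"] S(1) X by auto
    then show ?thesis unfolding img[symmetric] by blast
  qed
  moreover have "subuniverse B (carrier B)"
    using assms(2) hom by (auto simp: subuniverse_def closed_under_wedge_def is_algebra_def
        simp flip: img hom)
  ultimately have "subuniverse B hull (f ` X) = carrier B"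
    using image_mono[OF X(2), of f] unfolding img by (intro hull_unique) auto
  then show ?thesis
    unfolding finitely_generated_def using X(1,2) img by (intro exI[of _ "f ` X"]) auto
qed

theorem theorem5p3:
  assumes "infinite (UNIV :: 'u set)"
  shows "inherently_nonfinitely_based (SPS :: 'u groupoid set)"
proof -
  have "\<not> locally_finite W" if fb: "finitely_based W" and sub: "SPS \<subseteq> W" for W :: "'u groupoid set"
  proof
    assume lf: "locally_finite W"
    obtain \<Sigma> where \<Sigma>: "finite \<Sigma>" and W: "W = models \<Sigma>"
      using fb by (auto simp: finitely_based_def)
    have E2: "is_algebra E2" "countable (carrier E2)"
      using E2_pseudosemilattice by (simp_all add: models_def E2_def)
    obtain C :: "'u groupoid" where C: "isomorphic E2 C"
      using exists_isomorphic_copy[OF assms E2(2,1)] by blast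
    have "E2 \<in> models {e. satisfies E2 e}" using E2 by (simp add: models_def)
    then have "C \<in> models \<Sigma>"
      using isomorphic_models_iff[OF C E2(1)] sub SPS_eq_models[OF assms] W by auto
    then have sat: "satisfies E2 e" if "e \<in> \<Sigma>" for e
      using isomorphic_models_iff[OF C E2(1)] that by (auto simp: models_def)
    \<comment> \<open>One more than the number of variables suffices to cut the cycle; the other one ensures that
      the cycle has at least two left vertices, so that the intervals can be prolonged.\<close>
    let ?V = "\<Union>e \<in> \<Sigma>. vars (fst e)"
    define N where "N = int (card ?V) + 2"
    have "satisfies (winding N) e" if "e \<in> \<Sigma>" for e
    proof -
      have "card (vars (fst e)) \<le> card ?V"
        using that \<Sigma> by (intro card_mono) auto
      then show ?thesis
        using winding_satisfies[of "fst e" "snd e" N] sat[OF that] by (simp add: N_def)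
    qed
    then have model: "winding N \<in> models \<Sigma>"
      using winding_is_algebra by (simp add: models_def)
    obtain B :: "'u groupoid" where B: "isomorphic (winding N) B"
      using exists_isomorphic_copy[OF assms _ winding_is_algebra] by blast
    have "B \<in> W"
      using model isomorphic_models_iff[OF B winding_is_algebra] W by simp
    moreover have "finitely_generated B"
      using isomorphic_finitely_generated[OF B winding_is_algebra] winding_finitely_generated
      by (simp add: N_def)
    ultimately have "finite (carrier B)"
      using lf by (simp add: locally_finite_def)
    moreover have "infinite (carrier (winding N))"
      by (rule infinite_winding) (simp add: N_def)
    ultimately show False
      using B bij_betw_finite by (auto simp: isomorphic_def)
  qed
  moreover have "variety (SPS :: 'u groupoid set)"
    using SPS_eq_models[OF assms] by (auto simp: variety_def)
  ultimately show ?thesis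
    using locally_finite_SPS[OF assms] by (auto simp: inherently_nonfinitely_based_def)
qed

end
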